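(* For all $x\in\mathbb{D}$ and $v\in T_x\mathbb{D}\cong\mathbb{R}^2$ one has $(\pi^*F_L)(x,v)=F_P(x,v)$; that is, the pullback of the metric $F_L$ on the upper sheet $\mathbb{H}_+$ of the hyperboloid of two sheets by the map $\pi$ is the Finsler-Poincaré metric on the unit disc.
   Context: $\mathbb{D}=\{x=(x_1,x_2)\in\mathbb{R}^2: |x|<1\}$, with $|\cdot|$ and $\langle\cdot,\cdot\rangle$ the Euclidean norm and inner product. The Finsler-Poincaré metric on $\mathbb{D}$ is $F_P(x,v)=\dfrac{2|v|}{1-|x|^2}+\dfrac{4\langle x,v\rangle}{1-|x|^4}$. On $\mathbb{R}^3_+=\{\tilde x\in\mathbb{R}^3:\tilde x_3>0\}$ let $F_L(\tilde x,\tilde v)=\sqrt{\tilde v_1^2+\tilde v_2^2-\tilde v_3^2}+\dfrac{\tilde v_3}{\tilde x_3}$ (defined for those $\tilde v\in\mathbb{R}^3$ for which the radicand is non-negative, in particular for $\tilde v$ tangent to $\mathbb{H}_+$ at $\tilde x\in\mathbb{H}_+$). Here $\mathbb{H}_+=\{\tilde x\in\mathbb{R}^3:\tilde x_3=\sqrt{1+\tilde x_1^2+\tilde x_2^2}\}$ and $\pi:\mathbb{D}\to\mathbb{H}_+$ is the diffeomorphism $\pi(x)=\left(\dfrac{2x}{1-|x|^2},\dfrac{1+|x|^2}{1-|x|^2}\right)$. The pullback is $(\pi^*F_L)(x,v)=F_L(\pi(x),D\pi_x(v))$. *)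

theory Defs
  imports "HOL-Analysis.Analysis"
begin

abbreviation unit_disc :: "(real^2) set" where
  "unit_disc \<equiv> ball 0 1"

definition finsler_poincare :: "real^2 \<Rightarrow> real^2 \<Rightarrow> real" where
  "finsler_poincare x v =
     2 * norm v / (1 - (norm x)\<^sup>2) + 4 * (x \<bullet> v) / (1 - norm x ^ 4)"

definition upper_half_space :: "(real^3) set" where
  "upper_half_space = {x. x$3 > 0}"

definition upper_sheet :: "(real^3) set" where
  "upper_sheet = {x. x$3 = sqrt (1 + (x$1)\<^sup>2 + (x$2)\<^sup>2)}"

text \<open>
  The metric below is a partial function: it is only meaningful on the following set.
  Outside it, \<^term>\<open>sqrt\<close> of a negative number and division by zero take
  the library's default values.
\<close>

definition finsler_L_domain :: "((real^3) \<times> (real^3)) set" where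
  "finsler_L_domain =
     {(x, v). x \<in> upper_half_space \<and> (v$1)\<^sup>2 + (v$2)\<^sup>2 - (v$3)\<^sup>2 \<ge> 0}"

definition finsler_L :: "real^3 \<Rightarrow> real^3 \<Rightarrow> real" where
  "finsler_L x v = sqrt ((v$1)\<^sup>2 + (v$2)\<^sup>2 - (v$3)\<^sup>2) + v$3 / x$3"

definition disc_to_sheet :: "real^2 \<Rightarrow> real^3" where
  "disc_to_sheet x =
     vector [2 * x$1 / (1 - (norm x)\<^sup>2),
             2 * x$2 / (1 - (norm x)\<^sup>2),
             (1 + (norm x)\<^sup>2) / (1 - (norm x)\<^sup>2)]"

definition pullback ::
  "('a::real_normed_vector \<Rightarrow> 'b::real_normed_vector) \<Rightarrow> ('b \<Rightarrow> 'b \<Rightarrow> real) \<Rightarrow> 'a \<Rightarrow> 'a \<Rightarrow> real" where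
  "pullback f F x v = F (f x) (frechet_derivative f (at x) v)"

end

theory Submission
  imports Defs
begin

text \<open>Put s = 1 - |x|^2 and t = <x,v>. Differentiating the map gives the tangent vector (2v/s
  + 4tx/s^2, 4t/s^2), and each summand of \<open>finsler_L\<close> pulls back separately. In the
  Lorentz form the terms containing t cancel, because |x|^2 - 1 = -s; what remains is (2|v|/s)^2,
  the conformal Poincare metric (\<open>lorentz_disc_to_sheet_deriv\<close>). The one-form v3/x3
  becomes (4t/s^2) / ((1 + |x|^2)/s) = 4t/(1 - |x|^4)
  (\<open>disc_to_sheet_deriv_height_ratio\<close>). That the radicand is a square also shows that
  the pair lies in the domain of \<open>finsler_L\<close>.\<close>

lemma has_derivative_vec_componentwise:
  fixes f :: "'a::real_normed_vector \<Rightarrow> real^'n"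
  assumes "\<And>i. ((\<lambda>x. f x $ i) has_derivative (\<lambda>v. f' v $ i)) (at x within S)"
  shows "(f has_derivative f') (at x within S)"
  using assms
  by (auto simp: has_derivative_componentwise_within[of f] Basis_vec_def inner_axis)

lemma norm_lt_1_imp_power2_lt_1:
  fixes x :: "'a::real_normed_vector"
  assumes "norm x < 1"
  shows "(norm x)\<^sup>2 < 1"
  using assms by (simp add: abs_square_less_1)

lemma power2_norm_real_2: "(norm x)\<^sup>2 = (x$1)\<^sup>2 + (x$2)\<^sup>2" for x :: "real^2"
  unfolding power2_norm_eq_inner by (simp add: inner_vec_def sum_2 power2_eq_square)

text \<open>The differential in closed form: the terms over s^2 come from the derivative 2<x,v>/s^2
  of 1/s, and the height is 2/s - 1.\<close>

definition disc_to_sheet_deriv :: "real^2 \<Rightarrow> real^2 \<Rightarrow> real^3" where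
  "disc_to_sheet_deriv x v =
     (let s = 1 - (norm x)\<^sup>2 in
      vector [2 * v$1 / s + 4 * x$1 * (x \<bullet> v) / s\<^sup>2,
              2 * v$2 / s + 4 * x$2 * (x \<bullet> v) / s\<^sup>2,
              4 * (x \<bullet> v) / s\<^sup>2])"

lemma has_derivative_disc_to_sheet:
  assumes "norm x < 1"
  shows "(disc_to_sheet has_derivative disc_to_sheet_deriv x) (at x)"
proof (rule has_derivative_vec_componentwise)
  fix i :: 3
  \<comment> \<open>The squared norm is handled as \<open>x \<bullet> x\<close>, which is
    differentiable everywhere, whereas \<open>norm\<close> is not at the centre of the disc.\<close>
  have ne: "1 - x \<bullet> x \<noteq> 0"
    using norm_lt_1_imp_power2_lt_1[OF assms] by (simp add: power2_norm_eq_inner)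
  have coord: "((\<lambda>y. 2 * y$j / (1 - y \<bullet> y)) has_derivative
      (\<lambda>v. 2 * v$j / (1 - x \<bullet> x) + 4 * x$j * (x \<bullet> v) / (1 - x \<bullet> x)\<^sup>2)) (at x)" for j
    by (rule derivative_eq_intros refl bounded_linear_imp_has_derivative bounded_linear_vec_nth ne)+
       (use ne in \<open>simp add: fun_eq_iff field_simps power2_eq_square inner_commute\<close>)
  have height: "((\<lambda>y. (1 + y \<bullet> y) / (1 - y \<bullet> y)) has_derivative
      (\<lambda>v. 4 * (x \<bullet> v) / (1 - x \<bullet> x)\<^sup>2)) (at x)"
    by (rule derivative_eq_intros refl ne)+
       (use ne in \<open>simp add: fun_eq_iff field_simps power2_eq_square inner_commute\<close>)
  show "((\<lambda>y. disc_to_sheet y $ i) has_derivative (\<lambda>v. disc_to_sheet_deriv x v $ i)) (at x)"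
    using coord[of 1] coord[of 2] height exhaust_3[of i]
    by (auto simp: disc_to_sheet_def disc_to_sheet_deriv_def Let_def vector_3 power2_norm_eq_inner)
qed

text \<open>With r = |x|^2 this is (1 - r)^2 + 4r = (1 + r)^2; positivity of (1 + r)/(1 - r) selects
  the upper sheet.\<close>

lemma disc_to_sheet_in_upper_sheet:
  assumes "norm x < 1"
  shows "disc_to_sheet x \<in> upper_sheet"
proof -
  define r where "r = (norm x)\<^sup>2"
  have r: "r < 1" "0 \<le> r"
    using norm_lt_1_imp_power2_lt_1[OF assms] by (simp_all add: r_def)
  have r_eq: "r = (x$1)\<^sup>2 + (x$2)\<^sup>2"
    by (simp add: r_def power2_norm_real_2)
  have "1 + (2 * x$1 / (1 - r))\<^sup>2 + (2 * x$2 / (1 - r))\<^sup>2 = 1 + 4 * r / (1 - r)\<^sup>2"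
    by (simp add: r_eq power_divide power_mult_distrib add_divide_distrib)
  also have "\<dots> = ((1 - r)\<^sup>2 + 4 * r) / (1 - r)\<^sup>2"
    using r by (simp add: add_divide_distrib)
  also have "(1 - r)\<^sup>2 + 4 * r = (1 + r)\<^sup>2"
    by algebra
  also have "(1 + r)\<^sup>2 / (1 - r)\<^sup>2 = ((1 + r) / (1 - r))\<^sup>2"
    by (simp add: power_divide)
  finally show ?thesis
    using r by (simp add: upper_sheet_def disc_to_sheet_def vector_3 flip: r_def)
qed

lemma upper_sheet_subset_upper_half_space: "upper_sheet \<subseteq> upper_half_space"
  by (auto simp: upper_sheet_def upper_half_space_def add_pos_nonneg)

lemma lorentz_disc_to_sheet_deriv:
  assumes "norm x < 1"
  shows "(disc_to_sheet_deriv x v $ 1)\<^sup>2 + (disc_to_sheet_deriv x v $ 2)\<^sup>2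
           - (disc_to_sheet_deriv x v $ 3)\<^sup>2 = (2 * norm v / (1 - (norm x)\<^sup>2))\<^sup>2"
proof -
  define s t where "s = 1 - (norm x)\<^sup>2" and "t = x \<bullet> v"
  have s: "s \<noteq> 0"
    using norm_lt_1_imp_power2_lt_1[OF assms] by (simp add: s_def)
  have x: "(x$1)\<^sup>2 + (x$2)\<^sup>2 = 1 - s" and v: "(v$1)\<^sup>2 + (v$2)\<^sup>2 = (norm v)\<^sup>2"
    and xv: "x$1 * v$1 + x$2 * v$2 = t"
    by (simp_all add: s_def t_def power2_norm_real_2 inner_vec_def sum_2)
  \<comment> \<open>Expand and collect by powers of t. Since |x|^2 - 1 = -s, the quadratic term
    becomes -16t^2/s^3 and cancels the middle one.\<close>
  have "(2 * v$1 / s + 4 * x$1 * t / s\<^sup>2)\<^sup>2 + (2 * v$2 / s + 4 * x$2 * t / s\<^sup>2)\<^sup>2 - (4 * t / s\<^sup>2)\<^sup>2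
      = 4 * ((v$1)\<^sup>2 + (v$2)\<^sup>2) / s\<^sup>2 + 16 * t * (x$1 * v$1 + x$2 * v$2) / s ^ 3
          + 16 * t\<^sup>2 * ((x$1)\<^sup>2 + (x$2)\<^sup>2 - 1) / s ^ 4"
    using s by (simp add: field_simps power2_eq_square power3_eq_cube power4_eq_xxxx)
  also have "\<dots> = (2 * norm v / s)\<^sup>2"
    unfolding x v xv using s by (simp add: field_simps power2_eq_square power3_eq_cube power4_eq_xxxx)
  finally show ?thesis
    by (simp add: disc_to_sheet_deriv_def Let_def vector_3 flip: s_def t_def)
qed

text \<open>One factor 1 - |x|^2 cancels against the denominator of the height, and the other joins
  1 + |x|^2 to form 1 - |x|^4.\<close>

lemma disc_to_sheet_deriv_height_ratio:
  assumes "norm x < 1"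
  shows "disc_to_sheet_deriv x v $ 3 / disc_to_sheet x $ 3 = 4 * (x \<bullet> v) / (1 - norm x ^ 4)"
proof -
  define r where "r = (norm x)\<^sup>2"
  have r: "r < 1" "0 \<le> r"
    using norm_lt_1_imp_power2_lt_1[OF assms] by (simp_all add: r_def)
  have "norm x ^ 4 = r\<^sup>2"
    by (simp add: r_def flip: power_mult)
  then have "1 - norm x ^ 4 = (1 - r) * (1 + r)"
    by (simp add: algebra_simps power2_eq_square)
  then show ?thesis
    \<comment> \<open>\<open>power2_eq_square\<close> turns the squared norm into a product, so r
      must be folded back from that form.\<close>
    using r by (simp add: disc_to_sheet_deriv_def disc_to_sheet_def Let_def vector_3
        power2_eq_square flip: r_def[unfolded power2_eq_square])
qed

theorem proposition3p3:
  fixes x v :: "real^2"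
  assumes "x \<in> unit_disc"
  shows "disc_to_sheet differentiable (at x) \<and>
         disc_to_sheet x \<in> upper_sheet \<and>
         (disc_to_sheet x, frechet_derivative disc_to_sheet (at x) v) \<in> finsler_L_domain \<and>
         pullback disc_to_sheet finsler_L x v = finsler_poincare x v"
proof -
  have x: "norm x < 1"
    using assms by simp
  note D = has_derivative_disc_to_sheet[OF x]
  have fd: "frechet_derivative disc_to_sheet (at x) = disc_to_sheet_deriv x"
    using frechet_derivative_at[OF D] by simp
  \<comment> \<open>By this sign the root of the squared radicand is the number itself, without an
    absolute value.\<close>
  have "0 \<le> 2 * norm v / (1 - (norm x)\<^sup>2)"
    using norm_lt_1_imp_power2_lt_1[OF x] by simp
  then have "pullback disc_to_sheet finsler_L x v = finsler_poincare x v"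
    unfolding pullback_def fd finsler_L_def finsler_poincare_def lorentz_disc_to_sheet_deriv[OF x]
      disc_to_sheet_deriv_height_ratio[OF x]
    by (simp only: real_sqrt_abs abs_of_nonneg)
  \<comment> \<open>So neither the root nor the quotient in \<open>finsler_L\<close> takes a default
    value here.\<close>
  moreover have "(disc_to_sheet x, frechet_derivative disc_to_sheet (at x) v) \<in> finsler_L_domain"
    unfolding fd finsler_L_domain_def mem_Collect_eq prod.case lorentz_disc_to_sheet_deriv[OF x]
    using disc_to_sheet_in_upper_sheet[OF x] upper_sheet_subset_upper_half_space by auto
  ultimately show ?thesis
    using differentiableI[OF D] disc_to_sheet_in_upper_sheet[OF x] by blast
qed

end
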